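(* Let $X$ be a finite graph with adjacency matrix $A$, let $U(t)=\exp(itA)$ for $t\in\mathbb{R}$, and let $\overline{G}$ be the closure of $G=\{U(t):t\in\mathbb{R}\}$. Let $u,v$ be distinct vertices of $X$ and suppose there is pretty good state transfer from $u$ to $v$ in $X$. Then for each $\epsilon>0$ there is a real number $T$ such that for each $s\in\mathbb{R}$ the set $\{U(t+s):0\le t\le T\}$ contains an element within distance $\epsilon$ of a matrix $M\in\overline{G}$ satisfying $$M_{u,u}=M_{v,v}=0,\qquad M_{u,v}=M_{v,u}=\gamma$$ for some complex number $\gamma$ with $|\gamma|=1$.
   Context: Graphs are finite, simple and undirected. For distinct vertices $u,v$ there is pretty good state transfer from $u$ to $v$ if there is a complex number $\gamma$ (necessarily $|\gamma|=1$) such that for each real $\epsilon>0$ there is a time $t\in\mathbb{R}$ with $\|U(t)e_u-\gamma e_v\|<\epsilon$, where $e_a$ denotes the standard basis vector indexed by the vertex $a$. $G$ is a subgroup of the unitary group on $\mathbb{C}^n$, $n=|V(X)|$, and the closure is taken in the space of $n\times n$ complex matrices. Distances between matrices are measured in the operator norm. *)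

theory Defs
  imports "HOL-Analysis.Analysis"
begin

text \<open>The vertex set is the finite type of the edge relation, so that \<open>n = CARD('v)\<close>.\<close>

definition simple_graph :: "'v::finite rel \<Rightarrow> bool" where
  "simple_graph E \<longleftrightarrow> sym E \<and> irrefl E"

definition adjacency_matrix :: "'v::finite rel \<Rightarrow> complex^'v^'v" where
  "adjacency_matrix E = (\<chi> a b. if (a, b) \<in> E then 1 else 0)"

text \<open>
  The multiplication and \<open>1\<close> that the type of vectors inherits from its entries are
  componentwise, so powers and the exponential of a matrix are defined from \<open>**\<close> and \<open>mat 1\<close>.
\<close>

primrec matrix_power :: "'a::semiring_1^'n::finite^'n \<Rightarrow> nat \<Rightarrow> 'a^'n^'n" where
  "matrix_power M 0 = mat 1"
| "matrix_power M (Suc k) = M ** matrix_power M k"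

definition matrix_exp :: "complex^'n::finite^'n \<Rightarrow> complex^'n^'n" where
  "matrix_exp M = (\<Sum>k. (1 / fact k) *\<^sub>R matrix_power M k)"

lemma summable_matrix_exp:
  fixes M :: "complex^'n::finite^'n"
  shows "summable (\<lambda>k. (1 / fact k) *\<^sub>R matrix_power M k)"
proof -
  define c where "c = real CARD('n) * norm M"
  have c0: "c \<ge> 0" by (simp add: c_def)
  have entry: "cmod (M $ i $ j) \<le> norm M" for i j
    by (meson Finite_Cartesian_Product.norm_nth_le order_trans)
  have pow: "cmod (matrix_power M k $ i $ j) \<le> c ^ k" for k i j
  proof (induction k arbitrary: i j)
    case 0
    then show ?case by (simp add: mat_def)
  next
    case (Suc k)
    have "cmod (matrix_power M (Suc k) $ i $ j)
        \<le> (\<Sum>l\<in>UNIV. cmod (M $ i $ l * matrix_power M k $ l $ j))"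
      by (simp add: matrix_matrix_mult_def norm_sum)
    also have "\<dots> \<le> (\<Sum>l\<in>(UNIV::'n set). norm M * c ^ k)"
      unfolding norm_mult by (intro sum_mono mult_mono entry Suc) auto
    also have "\<dots> = c ^ Suc k" by (simp add: c_def)
    finally show ?case .
  qed
  have norm_pow: "norm (matrix_power M k) \<le> real CARD('n) * (real CARD('n) * c ^ k)" for k
  proof -
    have row: "norm (matrix_power M k $ i) \<le> real CARD('n) * c ^ k" for i
    proof -
      have "norm (matrix_power M k $ i) \<le> (\<Sum>j\<in>UNIV. cmod (matrix_power M k $ i $ j))"
        unfolding norm_vec_def by (rule L2_set_le_sum) simp
      also have "\<dots> \<le> (\<Sum>j\<in>(UNIV::'n set). c ^ k)" by (intro sum_mono pow)
      finally show ?thesis by simp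
    qed
    have "norm (matrix_power M k) \<le> (\<Sum>i\<in>UNIV. norm (matrix_power M k $ i))"
      unfolding norm_vec_def[of "matrix_power M k"] by (rule L2_set_le_sum) simp
    also have "\<dots> \<le> (\<Sum>i\<in>(UNIV::'n set). real CARD('n) * c ^ k)" by (intro sum_mono row)
    finally show ?thesis by simp
  qed
  show ?thesis
  proof (rule summable_comparison_test')
    show "summable (\<lambda>k. (real CARD('n) * real CARD('n)) * (inverse (fact k) * c ^ k))"
      by (intro summable_mult summable_exp)
    show "norm ((1 / fact k) *\<^sub>R matrix_power M k)
        \<le> (real CARD('n) * real CARD('n)) * (inverse (fact k) * c ^ k)" for k
      using mult_left_mono[OF norm_pow, of "inverse (fact k)" k]
      by (simp add: field_simps)
  qed
qed

definition transition_matrix :: "'v::finite rel \<Rightarrow> real \<Rightarrow> complex^'v^'v" where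
  "transition_matrix E t =
     matrix_exp (\<chi> a b. \<i> * complex_of_real t * adjacency_matrix E $ a $ b)"

definition pretty_good_state_transfer :: "'v::finite rel \<Rightarrow> 'v \<Rightarrow> 'v \<Rightarrow> bool" where
  "pretty_good_state_transfer E u v \<longleftrightarrow>
     (\<exists>\<gamma>::complex. \<forall>\<epsilon>>0. \<exists>t::real.
        norm (transition_matrix E t *v axis u 1 - \<gamma> *s axis v 1) < \<epsilon>)"

definition op_dist :: "complex^'n::finite^'n \<Rightarrow> complex^'n^'n \<Rightarrow> real" where
  "op_dist M N = onorm ((*v) (M - N))"

end

theory Submission
  imports Defs
begin

text \<open>
  The matrices \<open>U t\<close> are symmetric with orthonormal rows, and both properties pass to the compact
  closure \<open>K\<close> of \<open>range U\<close>. Pretty good state transfer therefore gives some \<open>M \<in> K\<close> whose column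
  \<open>u\<close> is \<open>\<gamma> e\<^sub>v\<close>; symmetry and the norms of the rows \<open>u\<close> and \<open>v\<close> force the remaining entries.
  Finitely many balls of small radius around \<open>U (t\<^sub>i)\<close> with \<open>\<bar>t\<^sub>i\<bar> \<le> L\<close> cover \<open>K\<close>. Since \<open>K\<close> is
  stable under multiplication by \<open>U (- s - L)\<close>, some \<open>U (t\<^sub>i)\<close> is close to \<open>U (- s - L) M\<close>, that is,
  \<open>U (t\<^sub>i + L + s)\<close> is close to \<open>M\<close>, and \<open>0 \<le> t\<^sub>i + L \<le> 2 L\<close>.
\<close>

section \<open>Powers and exponentials of matrices\<close>

lemma matrix_power_add:
  "matrix_power M (k + l) = matrix_power M k ** matrix_power M l"
  by (induction k) (simp_all add: matrix_mul_assoc)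

lemma matrix_power_Suc_right: "matrix_power M (Suc k) = matrix_power M k ** M"
  using matrix_power_add[of M k 1] by simp

lemma transpose_matrix_power:
  fixes M :: "'a::comm_semiring_1^'n::finite^'n"
  shows "transpose (matrix_power M k) = matrix_power (transpose M) k"
proof (induction k)
  case (Suc k)
  then show ?case
    by (metis matrix_power.simps(2) matrix_power_Suc_right matrix_transpose_mul)
qed (simp add: transpose_mat)

lemma matrix_power_scaled_nth:
  fixes M :: "'a::comm_semiring_1^'n::finite^'n"
  shows "matrix_power (\<chi> a b. c * M $ a $ b) k $ i $ j = c ^ k * matrix_power M k $ i $ j"
  by (induction k arbitrary: i j)
     (auto simp: mat_def matrix_matrix_mult_def sum_distrib_left mult_ac)

lemma norm_matrix_power_nth_le:
  fixes M :: "complex^'n::finite^'n"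
  shows "cmod (matrix_power M k $ i $ j) \<le> (real CARD('n) * norm M) ^ k"
proof (induction k arbitrary: i j)
  case 0
  then show ?case by (simp add: mat_def)
next
  case (Suc k)
  have entry: "cmod (M $ i $ l) \<le> norm M" for l
    by (meson Finite_Cartesian_Product.norm_nth_le order_trans)
  have "cmod (matrix_power M (Suc k) $ i $ j)
      \<le> (\<Sum>l\<in>UNIV. cmod (M $ i $ l * matrix_power M k $ l $ j))"
    by (simp add: matrix_matrix_mult_def norm_sum)
  also have "\<dots> \<le> (\<Sum>l\<in>(UNIV::'n set). norm M * (real CARD('n) * norm M) ^ k)"
    unfolding norm_mult by (intro sum_mono mult_mono entry Suc) auto
  finally show ?case by simp
qed

text \<open>Each entry is dominated by the exponential series of
  \<open>cmod c * (n * norm M)\<close>, where \<open>n\<close> is the number of vertices. Absolute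
  convergence is what the Cauchy product of two such series requires.\<close>

lemma summable_norm_matrix_exp_nth:
  fixes M :: "complex^'n::finite^'n"
  shows "summable (\<lambda>k. norm ((c ^ k /\<^sub>R fact k) * matrix_power M k $ i $ j))"
proof (rule summable_comparison_test')
  let ?b = "cmod c * (real CARD('n) * norm M)"
  show "summable (\<lambda>k. inverse (fact k) * ?b ^ k)" by (rule summable_exp)
  show "norm (norm ((c ^ k /\<^sub>R fact k) * matrix_power M k $ i $ j)) \<le> inverse (fact k) * ?b ^ k" for k
    using mult_left_mono[OF norm_matrix_power_nth_le[of M k i j], of "cmod c ^ k / fact k"]
    by (simp add: norm_mult norm_power power_mult_distrib field_simps)
qed

text \<open>Reading off an entry is bounded linear, so it commutes with the sum. This turns
  statements about \<open>matrix_exp\<close> into statements about scalar series;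
  \<open>transition_matrix\<close> is the case of the adjacency matrix with
  \<open>c = \<i> * t\<close>.\<close>

lemma matrix_exp_scaled_nth:
  fixes M :: "complex^'n::finite^'n"
  shows "matrix_exp (\<chi> a b. c * M $ a $ b) $ i $ j =
    (\<Sum>k. (c ^ k /\<^sub>R fact k) * matrix_power M k $ i $ j)"
proof -
  let ?M = "\<chi> a b. c * M $ a $ b"
  have "bounded_linear (\<lambda>X::complex^'n^'n. X $ i $ j)"
    by (intro bounded_linear_compose[OF bounded_linear_vec_nth] bounded_linear_vec_nth)
  from bounded_linear.suminf[OF this summable_matrix_exp[of ?M]]
  show ?thesis
    unfolding matrix_exp_def
    by (simp add: matrix_power_scaled_nth divide_inverse)
qed

text \<open>Both exponents are multiples of the same \<open>M\<close>, so the powers of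
  \<open>M\<close> combine by adding indices and only the scalars need the binomial theorem. The
  Cauchy product is taken entry by entry.\<close>

lemma matrix_exp_scaled_add:
  fixes M :: "complex^'n::finite^'n"
  shows "matrix_exp (\<chi> a b. (x + y) * M $ a $ b) =
    matrix_exp (\<chi> a b. x * M $ a $ b) ** matrix_exp (\<chi> a b. y * M $ a $ b)"
proof -
  define f where "f c i j k = (c ^ k /\<^sub>R fact k) * matrix_power M k $ i $ j" for c i j k
  have nth: "matrix_exp (\<chi> a b. c * M $ a $ b) $ i $ j = suminf (f c i j)" for c i j
    unfolding f_def by (rule matrix_exp_scaled_nth)
  have summable: "summable (\<lambda>k. norm (f c i j k))" for c i j
    unfolding f_def by (rule summable_norm_matrix_exp_nth)
  \<comment> \<open>For fixed \<open>m\<close>, summing over \<open>l\<close> multiplies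
    \<open>M^m\<close> by \<open>M^(k-m)\<close>, which gives \<open>M^k\<close> for every
    \<open>m\<close>. What remains is the scalar convolution for \<open>exp (x + y)\<close>.\<close>
  have coeff: "(\<Sum>l\<in>UNIV. \<Sum>m\<le>k. f x i l m * f y l j (k - m)) = f (x + y) i j k" for i j k
  proof -
    have "(\<Sum>l\<in>UNIV. \<Sum>m\<le>k. f x i l m * f y l j (k - m)) =
        (\<Sum>m\<le>k. (x ^ m /\<^sub>R fact m) * (y ^ (k - m) /\<^sub>R fact (k - m)) *
          (\<Sum>l\<in>UNIV. matrix_power M m $ i $ l * matrix_power M (k - m) $ l $ j))"
      unfolding f_def by (subst sum.swap) (simp add: sum_distrib_left mult_ac)
    also have "\<dots> = (\<Sum>m\<le>k. (x ^ m /\<^sub>R fact m) * (y ^ (k - m) /\<^sub>R fact (k - m)) *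
          matrix_power M k $ i $ j)"
    proof (intro sum.cong refl)
      fix m assume "m \<in> {..k}"
      then have "matrix_power M k = matrix_power M m ** matrix_power M (k - m)"
        by (simp flip: matrix_power_add)
      then show "(x ^ m /\<^sub>R fact m) * (y ^ (k - m) /\<^sub>R fact (k - m)) *
          (\<Sum>l\<in>UNIV. matrix_power M m $ i $ l * matrix_power M (k - m) $ l $ j) =
          (x ^ m /\<^sub>R fact m) * (y ^ (k - m) /\<^sub>R fact (k - m)) * matrix_power M k $ i $ j"
        by (simp add: matrix_matrix_mult_def)
    qed
    also have "\<dots> = f (x + y) i j k"
      unfolding f_def exp_series_add_commuting[OF mult.commute] by (simp add: sum_distrib_right)
    finally show ?thesis .
  qed
  have "(\<Sum>l\<in>UNIV. suminf (f x i l) * suminf (f y l j)) = suminf (f (x + y) i j)" for i j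
  proof -
    have "(\<lambda>k. \<Sum>l\<in>UNIV. \<Sum>m\<le>k. f x i l m * f y l j (k - m)) sums
        (\<Sum>l\<in>UNIV. suminf (f x i l) * suminf (f y l j))"
      by (intro sums_sum Cauchy_product_sums summable)
    then show ?thesis by (simp add: coeff sums_iff)
  qed
  then show ?thesis by (simp add: vec_eq_iff nth matrix_matrix_mult_def)
qed

section \<open>The transition matrix\<close>

lemma transition_matrix_add:
  "transition_matrix E (s + t) = transition_matrix E s ** transition_matrix E t"
  unfolding transition_matrix_def
  by (simp only: of_real_add distrib_left matrix_exp_scaled_add)

lemma transition_matrix_0: "transition_matrix E 0 = mat 1"
proof -
  have "transition_matrix E 0 $ i $ j = mat 1 $ i $ j" for i j
    unfolding transition_matrix_def matrix_exp_scaled_nth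
    by (subst suminf_finite[of "{0}"]) auto
  then show ?thesis by (simp add: vec_eq_iff)
qed

lemma transpose_adjacency_matrix:
  assumes "simple_graph E"
  shows "transpose (adjacency_matrix E) = adjacency_matrix E"
  using assms
  by (auto simp: simple_graph_def sym_def adjacency_matrix_def transpose_def vec_eq_iff)

lemma transition_matrix_symmetric:
  assumes "simple_graph E"
  shows "transition_matrix E t $ i $ j = transition_matrix E t $ j $ i"
proof -
  have "matrix_power (adjacency_matrix E) k $ i $ j = matrix_power (adjacency_matrix E) k $ j $ i" for k
    using transpose_matrix_power[of "adjacency_matrix E" k] transpose_adjacency_matrix[OF assms]
    by (simp add: transpose_def vec_eq_iff)
  then show ?thesis unfolding transition_matrix_def matrix_exp_scaled_nth by simp
qed

text \<open>The powers of the adjacency matrix are real, so conjugation acts only on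
  \<open>(\<i> * t) ^ k\<close> and reverses the sign of \<open>t\<close>.\<close>

lemma cnj_transition_matrix:
  "cnj (transition_matrix E t $ i $ j) = transition_matrix E (- t) $ i $ j"
proof -
  have real: "cnj (matrix_power (adjacency_matrix E) k $ i $ j) = matrix_power (adjacency_matrix E) k $ i $ j"
    for k i j
    by (induction k arbitrary: i j) (auto simp: mat_def matrix_matrix_mult_def adjacency_matrix_def intro!: sum.cong)
  have "summable (\<lambda>k. ((\<i> * of_real t) ^ k /\<^sub>R fact k) * matrix_power (adjacency_matrix E) k $ i $ j)"
    by (rule summable_norm_cancel[OF summable_norm_matrix_exp_nth])
  from bounded_linear.suminf[OF bounded_linear_cnj this]
  show ?thesis
    unfolding transition_matrix_def matrix_exp_scaled_nth by (simp add: real)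
qed

text \<open>By symmetry the conjugate of \<open>U(t)\<close> at \<open>(i, j)\<close> is the entry
  of \<open>U(-t)\<close> at \<open>(j, i)\<close>, so the squared norm of row \<open>i\<close> is a
  diagonal entry of \<open>U(t) ** U(-t) = mat 1\<close>.\<close>

lemma norm_transition_matrix_nth:
  assumes "simple_graph E"
  shows "norm (transition_matrix E t $ i) = 1"
proof -
  let ?U = "transition_matrix E"
  have "complex_of_real (\<Sum>j\<in>UNIV. (cmod (?U t $ i $ j))\<^sup>2) = (\<Sum>j\<in>UNIV. ?U t $ i $ j * ?U (- t) $ j $ i)"
    by (simp add: complex_norm_square cnj_transition_matrix transition_matrix_symmetric[OF assms, of _ i]
        del: of_real_power)
  also have "\<dots> = (?U t ** ?U (- t)) $ i $ i" by (simp add: matrix_matrix_mult_def)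
  also have "\<dots> = 1"
    unfolding transition_matrix_add[symmetric] by (simp add: transition_matrix_0 mat_def)
  finally have "(\<Sum>j\<in>UNIV. (cmod (?U t $ i $ j))\<^sup>2) = 1" using of_real_eq_1_iff by blast
  then show ?thesis by (simp add: norm_vec_def L2_set_def)
qed

text \<open>The norm on matrices here is the Frobenius norm. Its being constant along the orbit
  gives compactness of the closure and, later, a bound that is uniform in \<open>s\<close>.\<close>

lemma norm_transition_matrix:
  assumes "simple_graph (E :: 'v::finite rel)"
  shows "norm (transition_matrix E t) = sqrt (real CARD('v))"
  by (simp add: norm_vec_def[of "transition_matrix E t"] norm_transition_matrix_nth[OF assms] L2_set_def)

lemma closure_transition_matrix_symmetric:
  assumes "simple_graph E" and "M \<in> closure (range (transition_matrix E))"
  shows "M $ i $ j = M $ j $ i"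
proof -
  have "closure (range (transition_matrix E)) \<subseteq> {M. M $ i $ j = M $ j $ i}"
    using transition_matrix_symmetric[OF assms(1)]
    by (intro closure_minimal closed_Collect_eq continuous_intros) auto
  then show ?thesis using assms(2) by auto
qed

lemma norm_closure_transition_matrix_nth:
  assumes "simple_graph E" and "M \<in> closure (range (transition_matrix E))"
  shows "norm (M $ i) = 1"
proof -
  have "closure (range (transition_matrix E)) \<subseteq> {M. norm (M $ i) = 1}"
    using norm_transition_matrix_nth[OF assms(1)]
    by (intro closure_minimal closed_Collect_eq continuous_intros) auto
  then show ?thesis using assms(2) by auto
qed

lemma compact_closure_transition_matrix:
  assumes "simple_graph E"
  shows "compact (closure (range (transition_matrix E)))"
  unfolding compact_closure bounded_iff using norm_transition_matrix[OF assms] by (metis order_refl rangeE)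

text \<open>Left multiplication by \<open>U(s)\<close> is continuous and maps the orbit into itself,
  since times add.\<close>

lemma closure_transition_matrix_mult:
  assumes "M \<in> closure (range (transition_matrix E))"
  shows "transition_matrix E s ** M \<in> closure (range (transition_matrix E))"
proof -
  have "(\<lambda>X. transition_matrix E s ** X) ` closure (range (transition_matrix E))
      \<subseteq> closure (range (transition_matrix E))"
  proof (rule image_closure_subset)
    show "continuous_on (closure (range (transition_matrix E))) ((**) (transition_matrix E s))"
      unfolding matrix_matrix_mult_def by (intro continuous_intros)
    show "(**) (transition_matrix E s) ` range (transition_matrix E) \<subseteq> closure (range (transition_matrix E))"
      using closure_subset by (force simp flip: transition_matrix_add)
  qed simp
  then show ?thesis using assms by auto
qed

section \<open>Operator distance\<close>

text \<open>Cauchy-Schwarz bounds each coordinate by the norm of its row; taking the l2 norm over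
  the rows gives the Frobenius norm.\<close>

lemma norm_matrix_vector_mult_le:
  fixes A :: "'a::real_normed_field^'n::finite^'m::finite"
  shows "norm (A *v x) \<le> norm A * norm x"
proof -
  have "norm ((A *v x) $ i) \<le> norm (A $ i) * norm x" for i
  proof -
    have "norm ((A *v x) $ i) \<le> (\<Sum>j\<in>UNIV. \<bar>norm (A $ i $ j)\<bar> * \<bar>norm (x $ j)\<bar>)"
      by (simp add: matrix_vector_mult_def norm_sum flip: norm_mult)
    also have "\<dots> \<le> norm (A $ i) * norm x"
      unfolding norm_vec_def by (rule L2_set_mult_ineq)
    finally show ?thesis .
  qed
  then have "norm (A *v x) \<le> L2_set (\<lambda>i. norm (A $ i) * norm x) UNIV"
    unfolding norm_vec_def[of "A *v x"] by (intro L2_set_mono) auto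
  also have "\<dots> = norm A * norm x"
    by (simp add: norm_vec_def[of A] L2_set_left_distrib)
  finally show ?thesis .
qed

text \<open>Passes from Frobenius balls, which cover the closure, to the operator distance after a
  shift in time.\<close>

lemma op_dist_mult_left_le:
  "op_dist (C ** A) (C ** B) \<le> norm C * norm (A - B)"
  unfolding op_dist_def
proof (rule onorm_le)
  fix x
  have "(C ** A - C ** B) *v x = C *v ((A - B) *v x)"
    by (simp add: matrix_vector_mul_assoc matrix_vector_mult_diff_rdistrib matrix_vector_mult_diff_distrib)
  also have "norm \<dots> \<le> norm C * (norm (A - B) * norm x)"
    by (rule order_trans[OF norm_matrix_vector_mult_le mult_left_mono[OF norm_matrix_vector_mult_le]]) simp
  finally show "norm ((C ** A - C ** B) *v x) \<le> norm C * norm (A - B) * norm x"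
    by (simp add: mult.assoc)
qed

section \<open>Recurrence of state transfer\<close>

lemma pretty_good_state_transfer_limit:
  assumes "simple_graph E" and "u \<noteq> v" and "pretty_good_state_transfer E u v"
  obtains M \<gamma> where "M \<in> closure (range (transition_matrix E))" "cmod \<gamma> = 1"
    "M $ u $ u = 0" "M $ v $ v = 0" "M $ u $ v = \<gamma>" "M $ v $ u = \<gamma>"
proof -
  obtain \<gamma> where \<gamma>: "\<And>\<epsilon>. \<epsilon> > 0 \<Longrightarrow> \<exists>t. norm (transition_matrix E t *v axis u 1 - \<gamma> *s axis v 1) < \<epsilon>"
    using assms(3) unfolding pretty_good_state_transfer_def by blast
  let ?K = "closure (range (transition_matrix E))"
  let ?d = "\<lambda>X. norm (X *v axis u 1 - \<gamma> *s axis v 1)"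
  \<comment> \<open>Instead of extracting a convergent sequence of times, minimise the transfer
    defect over the compact closure. The hypothesis puts the minimum below every positive
    number.\<close>
  have "continuous_on ?K ?d"
    unfolding matrix_vector_mult_def by (intro continuous_intros)
  then obtain M where M: "M \<in> ?K" and min: "\<And>X. X \<in> ?K \<Longrightarrow> ?d M \<le> ?d X"
    using continuous_attains_inf[OF compact_closure_transition_matrix[OF assms(1)]] by fastforce
  have "?d M < \<epsilon>" if "\<epsilon> > 0" for \<epsilon>
    using \<gamma>[OF that] min closure_subset by (metis le_less_trans rangeI subsetD)
  from this[of "?d M"] have "?d M = 0" by fastforce
  then have "M *v axis u 1 = \<gamma> *s axis v 1" by simp
  then have col: "M $ i $ u = (if i = v then \<gamma> else 0)" for i
    by (auto simp: vec_eq_iff matrix_vector_mult_def axis_def if_distrib cong: if_cong)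
  have sym: "M $ i $ j = M $ j $ i" for i j
    by (rule closure_transition_matrix_symmetric[OF assms(1) M])
  have row: "norm (M $ i) = 1" for i
    by (rule norm_closure_transition_matrix_nth[OF assms(1) M])
  \<comment> \<open>By symmetry row \<open>u\<close> is also known: its only possible nonzero entry
    is \<open>\<gamma>\<close>, at \<open>v\<close>, so the unit norm of the row forces
    \<open>cmod \<gamma> = 1\<close>.\<close>
  have "cmod (M $ u $ j) ^ 2 = (if j = v then cmod \<gamma> ^ 2 else 0)" for j
    using col[of j] sym[of u j] by simp
  then have "cmod \<gamma> = 1" using row[of u] by (simp add: norm_vec_def L2_set_def)
  \<comment> \<open>The entry \<open>\<gamma>\<close> at position \<open>u\<close> of row
    \<open>v\<close> already uses up the unit norm of that row, which leaves 0 for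
    \<open>M $ v $ v\<close>.\<close>
  have "(\<Sum>j\<in>{u, v}. (cmod (M $ v $ j))\<^sup>2) \<le> (\<Sum>j\<in>UNIV. (cmod (M $ v $ j))\<^sup>2)"
    by (intro sum_mono2) auto
  also have "\<dots> = 1" using row[of v] by (simp add: norm_vec_def L2_set_def)
  finally have "M $ v $ v = 0" using assms(2) col[of v] \<open>cmod \<gamma> = 1\<close> by simp
  then show ?thesis
    using that[OF M \<open>cmod \<gamma> = 1\<close>] col[of u] col[of v] sym[of u v] assms(2) by simp
qed

lemma transition_matrix_relatively_dense:
  fixes E :: "'v::finite rel"
  assumes "simple_graph E" and M: "M \<in> closure (range (transition_matrix E))" and "\<epsilon> > 0"
  shows "\<exists>T. \<forall>s. \<exists>t. 0 \<le> t \<and> t \<le> T \<and> op_dist (transition_matrix E (t + s)) M < \<epsilon>"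
proof -
  let ?U = "transition_matrix E"
  \<comment> \<open>Compensates for the factor \<open>norm (U(s + L)) = sqrt n\<close> lost on
    multiplying back.\<close>
  define \<delta> where "\<delta> = \<epsilon> / sqrt (real CARD('v))"
  have "\<delta> > 0" using \<open>\<epsilon> > 0\<close> by (simp add: \<delta>_def)
  have "closure (range ?U) \<subseteq> (\<Union>t\<in>UNIV. ball (?U t) \<delta>)"
    using \<open>\<delta> > 0\<close> by (force simp: closure_approachable)
  then obtain C where "finite C" and C: "closure (range ?U) \<subseteq> (\<Union>t\<in>C. ball (?U t) \<delta>)"
    using compactE_image[OF compact_closure_transition_matrix[OF assms(1)], of UNIV "\<lambda>t. ball (?U t) \<delta>"]
    by auto
  obtain L where L: "\<And>t. t \<in> C \<Longrightarrow> \<bar>t\<bar> \<le> L"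
    using finite_imp_bounded[OF \<open>finite C\<close>] by (auto simp: bounded_iff)
  show ?thesis
  \<comment> \<open>The times in \<open>C\<close> lie in \<open>[-L, L]\<close>; adding
    \<open>L\<close> moves them into \<open>[0, 2 * L]\<close>, a window chosen before
    \<open>s\<close>.\<close>
  proof (rule exI[of _ "2 * L"], rule allI)
    fix s
    have "?U (- (s + L)) ** M \<in> closure (range ?U)" by (rule closure_transition_matrix_mult[OF M])
    then obtain r where r: "r \<in> C" "norm (?U r - ?U (- (s + L)) ** M) < \<delta>"
      using C by (force simp: dist_norm)
    have "?U (s + L) ** ?U r = ?U (r + L + s)"
      by (simp add: add_ac flip: transition_matrix_add)
    moreover have "?U (s + L) ** (?U (- (s + L)) ** M) = M"
      by (simp add: matrix_mul_assoc transition_matrix_0 flip: transition_matrix_add)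
    ultimately have "op_dist (?U (r + L + s)) M
        \<le> sqrt (real CARD('v)) * norm (?U r - ?U (- (s + L)) ** M)"
      using op_dist_mult_left_le[of "?U (s + L)" "?U r"] norm_transition_matrix[OF assms(1)] by metis
    also have "\<dots> < sqrt (real CARD('v)) * \<delta>" using r(2) by simp
    also have "\<dots> = \<epsilon>" by (simp add: \<delta>_def)
    finally show "\<exists>t. 0 \<le> t \<and> t \<le> 2 * L \<and> op_dist (?U (t + s)) M < \<epsilon>"
      using L[OF r(1)] by (intro exI[of _ "r + L"]) auto
  qed
qed

theorem corollary6p2:
  fixes E :: "'v::finite rel" and u v :: 'v
  assumes "simple_graph E"
    and "u \<noteq> v"
    and "pretty_good_state_transfer E u v"
  shows "\<forall>\<epsilon>>0. \<exists>T::real. \<forall>s::real.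
    \<exists>N \<in> {transition_matrix E (t + s) | t. 0 \<le> t \<and> t \<le> T}.
    \<exists>M \<in> closure (range (transition_matrix E)).
      op_dist N M < \<epsilon> \<and>
      (\<exists>\<gamma>::complex. cmod \<gamma> = 1 \<and>
         M $ u $ u = 0 \<and> M $ v $ v = 0 \<and> M $ u $ v = \<gamma> \<and> M $ v $ u = \<gamma>)"
proof (intro allI impI)
  fix \<epsilon> :: real
  assume "\<epsilon> > 0"
  \<comment> \<open>The limit is fixed before \<open>T\<close> and \<open>s\<close>, so one matrix
    serves every window.\<close>
  obtain M \<gamma> where M: "M \<in> closure (range (transition_matrix E))" "cmod \<gamma> = 1"
    "M $ u $ u = 0" "M $ v $ v = 0" "M $ u $ v = \<gamma>" "M $ v $ u = \<gamma>"
    using pretty_good_state_transfer_limit[OF assms] .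
  obtain T where T: "\<And>s. \<exists>t. 0 \<le> t \<and> t \<le> T \<and> op_dist (transition_matrix E (t + s)) M < \<epsilon>"
    using transition_matrix_relatively_dense[OF assms(1) M(1) \<open>\<epsilon> > 0\<close>] by blast
  show "\<exists>T. \<forall>s. \<exists>N \<in> {transition_matrix E (t + s) | t. 0 \<le> t \<and> t \<le> T}.
    \<exists>M \<in> closure (range (transition_matrix E)). op_dist N M < \<epsilon> \<and>
      (\<exists>\<gamma>. cmod \<gamma> = 1 \<and> M $ u $ u = 0 \<and> M $ v $ v = 0 \<and> M $ u $ v = \<gamma> \<and> M $ v $ u = \<gamma>)"
  proof (intro exI[of _ T] allI)
    fix s
    obtain t where "0 \<le> t" "t \<le> T" "op_dist (transition_matrix E (t + s)) M < \<epsilon>"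
      using T by blast
    with M show "\<exists>N \<in> {transition_matrix E (t + s) | t. 0 \<le> t \<and> t \<le> T}.
      \<exists>M \<in> closure (range (transition_matrix E)). op_dist N M < \<epsilon> \<and>
        (\<exists>\<gamma>. cmod \<gamma> = 1 \<and> M $ u $ u = 0 \<and> M $ v $ v = 0 \<and> M $ u $ v = \<gamma> \<and> M $ v $ u = \<gamma>)"
      by blast
  qed
qed

end
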